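(* Let $W$ be a finite set, $t\ge1$, and $T:W^t\to\mathbb R$ a tensor. There is a sum-of-squares proof of degree $2\lceil t/2\rceil$ of \[\{x_i^2\le1\}_{i\in W}\ \vdash_{2\lceil t/2\rceil}\ \sum_{\alpha\in W^t}T_\alpha x^\alpha\le K_G\,\|M(T)\|_{\infty\to1}.\]
   Context: For $\alpha\in W^t$, $x^\alpha=\prod_{j=1}^t x_{\alpha_j}$. The flattening $M(T)$ is the $W^{\lfloor t/2\rfloor}\times W^{\lceil t/2\rceil}$ matrix with $M(T)_{\beta\gamma}=T_{\beta\gamma}$ ($\beta\gamma$ the concatenated tuple). $\|M\|_{\infty\to1}=\sup\{x^\top My:\|x\|_\infty\le1,\|y\|_\infty\le1\}$. $K_G$ is the (real) Grothendieck constant. A degree-$d$ SoS proof of $p\le q$ from axioms $\{g_i\ge0\}$ is an identity $q-p=s_0+\sum_i s_ig_i$ with $s_0,s_i$ sums of squares of polynomials and every term of degree at most $d$. *)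

theory Defs
  imports Complex_Main "HOL-Library.Poly_Mapping"
begin

section \<open>Real polynomials in commuting variables\<close>

type_synonym 'v rpoly = "('v \<Rightarrow>\<^sub>0 nat) \<Rightarrow>\<^sub>0 real"

definition rconst :: "real \<Rightarrow> 'v rpoly" where
  "rconst c = Poly_Mapping.single 0 c"

definition rvar :: "'v \<Rightarrow> 'v rpoly" where
  "rvar i = Poly_Mapping.single (Poly_Mapping.single i 1) 1"

definition vars_in :: "'v set \<Rightarrow> 'v rpoly \<Rightarrow> bool" where
  "vars_in V p \<longleftrightarrow> (\<forall>m \<in> Poly_Mapping.keys p. Poly_Mapping.keys m \<subseteq> V)"

text \<open>The zero polynomial has degree at most every \<open>d\<close>.\<close>

definition degree_le :: "nat \<Rightarrow> 'v rpoly \<Rightarrow> bool" where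
  "degree_le d p \<longleftrightarrow>
     (\<forall>m \<in> Poly_Mapping.keys p. (\<Sum>i \<in> Poly_Mapping.keys m. Poly_Mapping.lookup m i) \<le> d)"


section \<open>Sum-of-squares proofs\<close>

definition is_sos :: "'v set \<Rightarrow> 'v rpoly \<Rightarrow> bool" where
  "is_sos V s \<longleftrightarrow> (\<exists>qs. (\<forall>q \<in> set qs. vars_in V q) \<and> s = (\<Sum>q\<leftarrow>qs. q\<^sup>2))"

text \<open>\<open>sos_proves V I g d p q\<close>: there is a degree-\<open>d\<close> sum-of-squares proof of \<open>p \<le> q\<close> in
  \<open>\<real>[V]\<close> from the finitely many axioms \<open>g i \<ge> 0\<close>, \<open>i \<in> I\<close>.\<close>

definition sos_proves ::
  "'v set \<Rightarrow> 'i set \<Rightarrow> ('i \<Rightarrow> 'v rpoly) \<Rightarrow> nat \<Rightarrow> 'v rpoly \<Rightarrow> 'v rpoly \<Rightarrow> bool" where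
  "sos_proves V I g d p q \<longleftrightarrow> finite I \<and>
     (\<exists>s0 s. is_sos V s0 \<and> (\<forall>i\<in>I. is_sos V (s i)) \<and>
             q - p = s0 + (\<Sum>i\<in>I. s i * g i) \<and>
             degree_le d s0 \<and> (\<forall>i\<in>I. degree_le d (s i * g i)))"


section \<open>Tensors and flattenings\<close>

definition tuples :: "'w set \<Rightarrow> nat \<Rightarrow> 'w list set" where
  "tuples W n = {\<alpha>. set \<alpha> \<subseteq> W \<and> length \<alpha> = n}"

definition tuple_monom :: "'w list \<Rightarrow> 'w rpoly" where
  "tuple_monom \<alpha> = (\<Prod>i\<leftarrow>\<alpha>. rvar i)"

definition flattening :: "('w list \<Rightarrow> real) \<Rightarrow> 'w list \<Rightarrow> 'w list \<Rightarrow> real" where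
  "flattening T \<beta> \<gamma> = T (\<beta> @ \<gamma>)"


section \<open>The norm from \<open>\<ell>\<^sub>\<infinity>\<close> to \<open>\<ell>\<^sub>1\<close> and the Grothendieck constant\<close>

definition norm_inf_1 :: "'a set \<Rightarrow> 'b set \<Rightarrow> ('a \<Rightarrow> 'b \<Rightarrow> real) \<Rightarrow> real" where
  "norm_inf_1 A B M =
     Sup {(\<Sum>a\<in>A. \<Sum>b\<in>B. x a * M a b * y b) | x y.
            (\<forall>a\<in>A. \<bar>x a\<bar> \<le> 1) \<and> (\<forall>b\<in>B. \<bar>y b\<bar> \<le> 1)}"

text \<open>The least \<open>K\<close> for which Grothendieck's inequality holds for all real matrices and all unit
  vectors \<open>u i\<close>, \<open>v j\<close> in a real Hilbert space.  Finitely many vectors are involved, so the Hilbert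
  space ranges over the Euclidean spaces of all finite dimensions \<open>d\<close>.  The infimum of reals is
  meaningful because Grothendieck's theorem provides some such \<open>K\<close>, and \<open>K \<ge> 1\<close> always.\<close>

definition Grothendieck_bound :: "real \<Rightarrow> bool" where
  "Grothendieck_bound K \<longleftrightarrow>
     (\<forall>(m::nat) (n::nat) (d::nat) (M :: nat \<Rightarrow> nat \<Rightarrow> real)
       (u :: nat \<Rightarrow> nat \<Rightarrow> real) (v :: nat \<Rightarrow> nat \<Rightarrow> real).
       (\<forall>i<m. (\<Sum>k<d. (u i k)\<^sup>2) = 1) \<longrightarrow> (\<forall>j<n. (\<Sum>k<d. (v j k)\<^sup>2) = 1) \<longrightarrow>
       \<bar>\<Sum>i<m. \<Sum>j<n. M i j * (\<Sum>k<d. u i k * v j k)\<bar> \<le> K * norm_inf_1 {..<m} {..<n} M)"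

definition K_G :: real where
  "K_G = Inf {K. Grothendieck_bound K}"

end

theory Submission
  imports Defs "HOL-Analysis.Convex_Euclidean_Space"
begin

text \<open>
  Write \<open>M\<close> for the flattening, \<open>c = K\<^sub>G \<parallel>M\<parallel>\<close> and \<open>z\<close> for the vector of all monomials indexed by the rows
  and columns of \<open>M\<close>.  Grothendieck's inequality says that the semidefinite relaxation of the
  bilinear form of \<open>M\<close> has value at most \<open>c\<close>.  By duality there are weights \<open>w \<ge> 0\<close> of total mass \<open>1\<close>
  such that the quadratic form \<open>c \<Sum>\<^sub>i w\<^sub>i z\<^sub>i\<^sup>2 - \<Sum>\<^sub>a\<^sub>b M\<^sub>a\<^sub>b z\<^sub>a z\<^sub>b\<close> is positive semidefinite, hence a sum of
  squares of linear forms.  Adding \<open>c \<Sum>\<^sub>i w\<^sub>i (1 - z\<^sub>i\<^sup>2)\<close> gives the certificate, since \<open>1 - z\<^sub>i\<^sup>2\<close>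
  telescopes into multiples of the axioms by squares.

  That \<open>K\<^sub>G\<close> is finite is Grothendieck's theorem.  It is proved (with constant \<open>8\<close>) by representing
  vectors as Rademacher sums and truncating these: the truncated parts are bounded by \<open>\<parallel>M\<parallel>\<close> pointwise,
  the remainders are small in \<open>L\<^sup>2\<close> by the fourth moment bound.

  The duality needs only that a convex set of functions on a finite set that avoids the open negative
  orthant lies in a half-space with nonnegative normal vector.
\<close>

section \<open>Grothendieck's inequality\<close>

lemma bdd_above_norm_inf_1:
  fixes M :: "'a \<Rightarrow> 'b \<Rightarrow> real"
  shows "bdd_above {(\<Sum>a\<in>A. \<Sum>b\<in>B. x a * M a b * y b) | x y.
            (\<forall>a\<in>A. \<bar>x a\<bar> \<le> 1) \<and> (\<forall>b\<in>B. \<bar>y b\<bar> \<le> 1)}"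
proof (rule bdd_aboveI[where M = "\<Sum>a\<in>A. \<Sum>b\<in>B. \<bar>M a b\<bar>"], clarify)
  fix x y :: "_ \<Rightarrow> real"
  assume xy: "\<forall>a\<in>A. \<bar>x a\<bar> \<le> 1" "\<forall>b\<in>B. \<bar>y b\<bar> \<le> 1"
  show "(\<Sum>a\<in>A. \<Sum>b\<in>B. x a * M a b * y b) \<le> (\<Sum>a\<in>A. \<Sum>b\<in>B. \<bar>M a b\<bar>)"
  proof (intro sum_mono)
    fix a b assume "a \<in> A" "b \<in> B"
    then have "\<bar>x a\<bar> * \<bar>M a b\<bar> * \<bar>y b\<bar> \<le> 1 * \<bar>M a b\<bar> * 1"
      using xy by (intro mult_mono) auto
    then show "x a * M a b * y b \<le> \<bar>M a b\<bar>"
      by (metis abs_ge_self abs_mult mult_1 mult.right_neutral order_trans)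
  qed
qed

lemma norm_inf_1_upper:
  fixes M :: "'a \<Rightarrow> 'b \<Rightarrow> real"
  assumes "\<And>a. a \<in> A \<Longrightarrow> \<bar>x a\<bar> \<le> 1" "\<And>b. b \<in> B \<Longrightarrow> \<bar>y b\<bar> \<le> 1"
  shows "(\<Sum>a\<in>A. \<Sum>b\<in>B. x a * M a b * y b) \<le> norm_inf_1 A B M"
  unfolding norm_inf_1_def
  by (rule cSup_upper[OF _ bdd_above_norm_inf_1]) (use assms in blast)

lemma norm_inf_1_nonneg: "0 \<le> norm_inf_1 A B M"
  using norm_inf_1_upper[of A "\<lambda>_. 0" B "\<lambda>_. 0" M] by simp

text \<open>Dividing \<open>x\<close> by \<open>r\<close> and \<open>y\<close> by \<open>s\<close>
  reduces the claim to the unit balls; replacing \<open>x\<close> by \<open>- x\<close> accounts for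
  the absolute value.\<close>

lemma abs_bilinear_le_norm_inf_1:
  fixes M :: "'a \<Rightarrow> 'b \<Rightarrow> real"
  assumes "r > 0" "s > 0" "\<And>a. a \<in> A \<Longrightarrow> \<bar>x a\<bar> \<le> r" "\<And>b. b \<in> B \<Longrightarrow> \<bar>y b\<bar> \<le> s"
  shows "\<bar>\<Sum>a\<in>A. \<Sum>b\<in>B. x a * M a b * y b\<bar> \<le> r * s * norm_inf_1 A B M"
proof -
  let ?F = "\<Sum>a\<in>A. \<Sum>b\<in>B. x a * M a b * y b"
  have *: "\<sigma> / (r * s) * ?F \<le> norm_inf_1 A B M" if "\<bar>\<sigma>\<bar> = 1" for \<sigma> :: real
  proof -
    have "(\<Sum>a\<in>A. \<Sum>b\<in>B. (\<sigma> * x a / r) * M a b * (y b / s)) \<le> norm_inf_1 A B M"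
      using assms that by (intro norm_inf_1_upper) (auto simp: abs_mult)
    then show ?thesis
      by (simp add: sum_distrib_left field_simps)
  qed
  show ?thesis
    using *[of 1] *[of "-1"] assms(1,2) by (simp add: field_simps abs_le_iff)
qed

text \<open>Test vectors are carried over along the inverse bijections. This links arbitrary finite
  index sets to the initial segments of the naturals in \<open>Grothendieck_bound\<close>.\<close>

lemma norm_inf_1_reindex_le:
  fixes M :: "'a \<Rightarrow> 'b \<Rightarrow> real"
  assumes f: "bij_betw f I A" and g: "bij_betw g J B"
  shows "norm_inf_1 I J (\<lambda>i j. M (f i) (g j)) \<le> norm_inf_1 A B M"
  unfolding norm_inf_1_def[of I J]
proof (rule cSup_least, goal_cases)
  case 1
  show ?case by (auto intro!: exI[of _ "\<lambda>_. 0"])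
next
  case (2 s)
  then obtain x y where s: "s = (\<Sum>i\<in>I. \<Sum>j\<in>J. x i * M (f i) (g j) * y j)"
    and xy: "\<forall>i\<in>I. \<bar>x i\<bar> \<le> 1" "\<forall>j\<in>J. \<bar>y j\<bar> \<le> 1" by blast
  have fi: "inv_into I f (f i) = i" if "i \<in> I" for i
    using f that by (auto simp: bij_betw_def)
  have gi: "inv_into J g (g j) = j" if "j \<in> J" for j
    using g that by (auto simp: bij_betw_def)
  have "s = (\<Sum>a\<in>A. \<Sum>b\<in>B. x (inv_into I f a) * M a b * y (inv_into J g b))"
    by (simp add: s fi gi sum.reindex_bij_betw[OF f, symmetric]
        sum.reindex_bij_betw[OF g, symmetric] cong: sum.cong)
  also have "\<dots> \<le> norm_inf_1 A B M"
    using xy f g by (intro norm_inf_1_upper) (auto simp: bij_betw_def intro!: inv_into_into)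
  finally show ?case .
qed


text \<open>Vectors range over unit balls instead of spheres, so that remainders of truncated
  vectors, whose norms are only bounded above, may be inserted. Fixing the matrix allows arguing
  about its best bound \<open>G\<close>.\<close>

definition hilbert_bound :: "'a set \<Rightarrow> 'b set \<Rightarrow> ('a \<Rightarrow> 'b \<Rightarrow> real) \<Rightarrow> real \<Rightarrow> bool" where
  "hilbert_bound A B M G \<longleftrightarrow>
     (\<forall>(d::nat) u v. (\<forall>a\<in>A. (\<Sum>k<d. (u a k)\<^sup>2) \<le> 1) \<longrightarrow> (\<forall>b\<in>B. (\<Sum>k<d. (v b k)\<^sup>2) \<le> 1) \<longrightarrow>
        \<bar>\<Sum>a\<in>A. \<Sum>b\<in>B. M a b * (\<Sum>k<d. u a k * v b k)\<bar> \<le> G)"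

text \<open>Homogeneity in \<open>u\<close> and \<open>v\<close>. Coordinates may be indexed by any
  finite set, later by the sign patterns \<open>Pow {..<d}\<close>.\<close>

lemma hilbert_bound_scaled:
  fixes u :: "'a \<Rightarrow> 'k \<Rightarrow> real" and v :: "'b \<Rightarrow> 'k \<Rightarrow> real"
  assumes G: "hilbert_bound A B M G" and D: "finite D" and r: "r \<ge> 0" and s: "s \<ge> 0"
    and u: "\<And>a. a \<in> A \<Longrightarrow> (\<Sum>k\<in>D. (u a k)\<^sup>2) \<le> r\<^sup>2"
    and v: "\<And>b. b \<in> B \<Longrightarrow> (\<Sum>k\<in>D. (v b k)\<^sup>2) \<le> s\<^sup>2"
  shows "\<bar>\<Sum>a\<in>A. \<Sum>b\<in>B. M a b * (\<Sum>k\<in>D. u a k * v b k)\<bar> \<le> G * (r * s)"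
proof (cases "r = 0 \<or> s = 0")
  case True
  \<comment> \<open>A radius 0 rules out normalising, but it forces one of the two vectors to
    vanish.\<close>
  have "(\<Sum>k\<in>D. u a k * v b k) = 0" if "a \<in> A" "b \<in> B" for a b
  proof -
    have "(\<Sum>k\<in>D. (u a k)\<^sup>2) = 0 \<or> (\<Sum>k\<in>D. (v b k)\<^sup>2) = 0"
      using True u[OF that(1)] v[OF that(2)]
      by (smt (verit) power_zero_numeral sum_nonneg zero_le_power2)
    then have "(\<forall>k\<in>D. u a k = 0) \<or> (\<forall>k\<in>D. v b k = 0)"
      using D by (simp add: sum_nonneg_eq_0_iff)
    then show ?thesis by (auto intro: sum.neutral)
  qed
  with True show ?thesis by auto
next
  case False
  with r s have pos: "r > 0" "s > 0" by auto
  obtain h where h: "bij_betw h {..<card D} D"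
    using D by (metis ex_bij_betw_nat_finite atLeast0LessThan)
  have u': "(\<Sum>k<card D. (u a (h k) / r)\<^sup>2) \<le> 1" if "a \<in> A" for a
    using u[OF that] pos
    by (simp add: sum.reindex_bij_betw[OF h, where g = "\<lambda>k. (u a k)\<^sup>2"] power_divide
        flip: sum_divide_distrib)
  have v': "(\<Sum>k<card D. (v b (h k) / s)\<^sup>2) \<le> 1" if "b \<in> B" for b
    using v[OF that] pos
    by (simp add: sum.reindex_bij_betw[OF h, where g = "\<lambda>k. (v b k)\<^sup>2"] power_divide
        flip: sum_divide_distrib)
  have *: "(\<Sum>k<card D. u a (h k) / r * (v b (h k) / s)) = (\<Sum>k\<in>D. u a k * v b k) / (r * s)"
    for a b
    by (subst sum.reindex_bij_betw[OF h, where g = "\<lambda>k. u a k / r * (v b k / s)"])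
      (simp add: sum_divide_distrib)
  have "\<bar>\<Sum>a\<in>A. \<Sum>b\<in>B. M a b * (\<Sum>k<card D. u a (h k) / r * (v b (h k) / s))\<bar> \<le> G"
    using G[unfolded hilbert_bound_def, rule_format,
        where d = "card D" and u = "\<lambda>a k. u a (h k) / r" and v = "\<lambda>b k. v b (h k) / s"] u' v' by blast
  then have "\<bar>(\<Sum>a\<in>A. \<Sum>b\<in>B. M a b * (\<Sum>k\<in>D. u a k * v b k)) / (r * s)\<bar> \<le> G"
    unfolding * by (simp only: sum_divide_distrib[of _ A] sum_divide_distrib[of _ B] times_divide_eq_right)
  then show ?thesis
    using pos by (simp add: abs_mult field_simps)
qed

text \<open>Rademacher sums: a subset \<open>S\<close> of \<open>{..<d}\<close> is the set of indices that carry the sign \<open>-1\<close>.\<close>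

definition rademacher_sum :: "nat \<Rightarrow> (nat \<Rightarrow> real) \<Rightarrow> nat set \<Rightarrow> real" where
  "rademacher_sum d u S = (\<Sum>k<d. if k \<in> S then - u k else u k)"

lemma rademacher_sum_Suc:
  assumes "S \<subseteq> {..<d}"
  shows "rademacher_sum (Suc d) u S = rademacher_sum d u S + u d"
    and "rademacher_sum (Suc d) u (insert d S) = rademacher_sum d u S - u d"
proof -
  have "d \<notin> S" using assms by auto
  moreover have "(\<Sum>k<d. if k = d \<or> k \<in> S then - u k else u k) =
      (\<Sum>k<d. if k \<in> S then - u k else u k)"
    by (rule sum.cong) auto
  ultimately show "rademacher_sum (Suc d) u S = rademacher_sum d u S + u d"
    "rademacher_sum (Suc d) u (insert d S) = rademacher_sum d u S - u d"
    by (auto simp: rademacher_sum_def)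
qed

text \<open>Subsets are grouped by the sign at the new index \<open>d\<close>; this drives the
  induction in both moment computations.\<close>

lemma sum_Pow_lessThan_Suc:
  fixes f :: "nat set \<Rightarrow> real"
  shows "(\<Sum>S\<in>Pow {..<Suc d}. f S) = (\<Sum>S\<in>Pow {..<d}. f S + f (insert d S))"
proof -
  have inj: "inj_on (insert d) (Pow {..<d})"
    by (rule inj_onI) (metis PowD insert_ident lessThan_iff less_irrefl subsetD)
  have "Pow {..<d} \<inter> insert d ` Pow {..<d} = {}"
    by auto
  then show ?thesis
    by (simp add: lessThan_Suc Pow_insert sum.union_disjoint sum.reindex[OF inj] sum.distrib)
qed

text \<open>Cross terms cancel between the two signs of the new coordinate. Averaging over the
  \<open>2 ^ d\<close> sign patterns thus makes Rademacher sums an isometric copy of the vectors in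
  \<open>L\<^sup>2\<close>.\<close>

lemma rademacher_sum_inner:
  "(\<Sum>S\<in>Pow {..<d}. rademacher_sum d u S * rademacher_sum d v S) = 2 ^ d * (\<Sum>k<d. u k * v k)"
proof (induction d)
  case 0
  show ?case by (simp add: rademacher_sum_def)
next
  case (Suc d)
  have "(\<Sum>S\<in>Pow {..<Suc d}. rademacher_sum (Suc d) u S * rademacher_sum (Suc d) v S) =
      (\<Sum>S\<in>Pow {..<d}. 2 * (rademacher_sum d u S * rademacher_sum d v S) + 2 * (u d * v d))"
    unfolding sum_Pow_lessThan_Suc
    by (rule sum.cong) (auto simp: rademacher_sum_Suc algebra_simps)
  also have "\<dots> = 2 ^ Suc d * (\<Sum>k<Suc d. u k * v k)"
    by (simp add: sum.distrib Suc card_Pow algebra_simps flip: sum_distrib_left)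
  finally show ?case .
qed

text \<open>The fourth moment case of Khintchine's inequality.\<close>

lemma rademacher_sum_pow4:
  "(\<Sum>S\<in>Pow {..<d}. rademacher_sum d u S ^ 4) \<le> 3 * 2 ^ d * (\<Sum>k<d. (u k)\<^sup>2)\<^sup>2"
proof (induction d)
  case 0
  show ?case by (simp add: rademacher_sum_def)
next
  case (Suc d)
  let ?s = "\<Sum>k<d. (u k)\<^sup>2"
  have sq: "(\<Sum>S\<in>Pow {..<d}. (rademacher_sum d u S)\<^sup>2) = 2 ^ d * ?s"
    using rademacher_sum_inner[of d u u] by (simp add: power2_eq_square)
  \<comment> \<open>Uses (x + y)^4 + (x - y)^4 = 2 x^4 + 12 x^2 y^2 + 2 y^4.\<close>
  have "(\<Sum>S\<in>Pow {..<Suc d}. rademacher_sum (Suc d) u S ^ 4) =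
      (\<Sum>S\<in>Pow {..<d}. 2 * rademacher_sum d u S ^ 4 + 12 * (u d)\<^sup>2 * (rademacher_sum d u S)\<^sup>2
         + 2 * u d ^ 4)"
    unfolding sum_Pow_lessThan_Suc
    by (rule sum.cong) (auto simp: rademacher_sum_Suc power4_eq_xxxx power2_eq_square algebra_simps)
  also have "\<dots> = 2 * (\<Sum>S\<in>Pow {..<d}. rademacher_sum d u S ^ 4) + 12 * (u d)\<^sup>2 * (2 ^ d * ?s)
      + 2 * 2 ^ d * u d ^ 4"
    by (simp add: sum.distrib card_Pow sq flip: sum_distrib_left)
  \<comment> \<open>The coefficient of \<open>u d ^ 4\<close> is raised from 2 to 6 to complete the
    square.\<close>
  also have "\<dots> \<le> 2 * (3 * 2 ^ d * ?s\<^sup>2) + 12 * (u d)\<^sup>2 * (2 ^ d * ?s) + 6 * 2 ^ d * u d ^ 4"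
    using Suc by (intro add_mono mult_left_mono mult_right_mono) auto
  also have "\<dots> = 3 * 2 ^ Suc d * (\<Sum>k<Suc d. (u k)\<^sup>2)\<^sup>2"
    by (simp add: power4_eq_xxxx power2_eq_square algebra_simps)
  finally show ?case .
qed

text \<open>At truncation level 2 the mean square of a remainder is at most 3/64, which is below
  (1/4)^2.\<close>

definition clamp2 :: "real \<Rightarrow> real" where
  "clamp2 x = max (-2) (min x 2)"

lemma abs_clamp2_le: "\<bar>clamp2 x\<bar> \<le> 2"
  by (auto simp: clamp2_def)

lemma clamp2_sq_le: "(clamp2 x)\<^sup>2 \<le> x\<^sup>2"
  unfolding abs_le_square_iff[symmetric] by (auto simp: clamp2_def)

text \<open>Beyond the truncation level the remainder has absolute value |x| - 2, and |x| - 2 \<le>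
  x^2 / 8 rearranges to (|x| - 4)^2 \<ge> 0.\<close>

lemma clamp2_diff_sq_le: "(x - clamp2 x)\<^sup>2 \<le> x ^ 4 / 64"
proof -
  have "0 \<le> (x - 4)\<^sup>2" "0 \<le> (x + 4)\<^sup>2" by simp_all
  then have "\<bar>x - clamp2 x\<bar> \<le> x\<^sup>2 / 8"
    by (auto simp: clamp2_def max_def min_def power2_eq_square algebra_simps)
  then have "(x - clamp2 x)\<^sup>2 \<le> (x\<^sup>2 / 8)\<^sup>2"
    by (metis abs_ge_zero power2_abs power_mono)
  then show ?thesis
    by (simp add: power_divide flip: power_mult)
qed

text \<open>Truncating the Rademacher sums representing \<open>u\<close> and \<open>v\<close> leaves remainders of norm at most
  \<open>1/4\<close>, whose contributions are again controlled by the best Hilbert space bound \<open>G\<close>.\<close>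

lemma hilbert_bound_improve:
  assumes G: "hilbert_bound A B M G"
  shows "hilbert_bound A B M (4 * norm_inf_1 A B M + G / 2)"
  unfolding hilbert_bound_def
proof (intro allI impI)
  fix d :: nat and u v
  assume u: "\<forall>a\<in>A. (\<Sum>k<d. (u a k)\<^sup>2) \<le> (1::real)"
    and v: "\<forall>b\<in>B. (\<Sum>k<d. (v b k)\<^sup>2) \<le> (1::real)"
  let ?\<Omega> = "Pow {..<d}" and ?N = "norm_inf_1 A B M"
  \<comment> \<open>Sums over sign patterns replace averages, so every norm is scaled by
    \<open>q\<close> and every inner product by its square.\<close>
  define q :: real where "q = sqrt (2 ^ d)"
  have q: "q > 0" "q\<^sup>2 = 2 ^ d" by (auto simp: q_def)
  define X where "X a S = rademacher_sum d (u a) S" for a S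
  define Y where "Y b S = rademacher_sum d (v b) S" for b S
  have sq: "(\<Sum>S\<in>?\<Omega>. (rademacher_sum d w S)\<^sup>2) \<le> q\<^sup>2"
    and rest: "(\<Sum>S\<in>?\<Omega>. (rademacher_sum d w S - clamp2 (rademacher_sum d w S))\<^sup>2) \<le> (q / 4)\<^sup>2"
    and trunc: "(\<Sum>S\<in>?\<Omega>. (clamp2 (rademacher_sum d w S))\<^sup>2) \<le> q\<^sup>2"
    if w: "(\<Sum>k<d. (w k)\<^sup>2) \<le> 1" for w
  proof -
    show 1: "(\<Sum>S\<in>?\<Omega>. (rademacher_sum d w S)\<^sup>2) \<le> q\<^sup>2"
      using rademacher_sum_inner[of d w w] w by (simp add: q flip: power2_eq_square)
    show "(\<Sum>S\<in>?\<Omega>. (clamp2 (rademacher_sum d w S))\<^sup>2) \<le> q\<^sup>2"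
      by (rule order_trans[OF sum_mono 1]) (rule clamp2_sq_le)
    have "(\<Sum>S\<in>?\<Omega>. (rademacher_sum d w S - clamp2 (rademacher_sum d w S))\<^sup>2)
        \<le> (\<Sum>S\<in>?\<Omega>. rademacher_sum d w S ^ 4 / 64)"
      by (rule sum_mono) (rule clamp2_diff_sq_le)
    also have "\<dots> \<le> 3 * 2 ^ d * (\<Sum>k<d. (w k)\<^sup>2)\<^sup>2 / 64"
      using rademacher_sum_pow4[of d w] by (simp flip: sum_divide_distrib)
    also have "\<dots> \<le> 3 * 2 ^ d * 1\<^sup>2 / 64"
      using w by (intro divide_right_mono mult_left_mono power_mono) (auto intro: sum_nonneg)
    also have "\<dots> \<le> (q / 4)\<^sup>2"
      by (simp add: power_divide q)
    finally show "(\<Sum>S\<in>?\<Omega>. (rademacher_sum d w S - clamp2 (rademacher_sum d w S))\<^sup>2) \<le> (q / 4)\<^sup>2" .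
  qed
  define F where "F U V = (\<Sum>a\<in>A. \<Sum>b\<in>B. M a b * (\<Sum>S\<in>?\<Omega>. U a S * V b S))"
    for U :: "'a \<Rightarrow> nat set \<Rightarrow> real" and V :: "'b \<Rightarrow> nat set \<Rightarrow> real"
  let ?TX = "\<lambda>a S. clamp2 (X a S)" and ?TY = "\<lambda>b S. clamp2 (Y b S)"
  let ?RX = "\<lambda>a S. X a S - clamp2 (X a S)" and ?RY = "\<lambda>b S. Y b S - clamp2 (Y b S)"
  have "q\<^sup>2 * (\<Sum>a\<in>A. \<Sum>b\<in>B. M a b * (\<Sum>k<d. u a k * v b k)) = F X Y"
    unfolding F_def X_def Y_def rademacher_sum_inner
    by (simp add: q sum_distrib_left mult.left_commute)
  \<comment> \<open>Each of the last two terms pairs a remainder of norm at most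
    \<open>q / 4\<close> with a vector of norm at most \<open>q\<close>, so each costs
    \<open>G / 4\<close> after normalising.\<close>
  also have "F X Y = F ?TX ?TY + F ?RX Y + F ?TX ?RY"
    unfolding F_def by (simp add: sum_distrib_left algebra_simps flip: sum.distrib)
  finally have split: "q\<^sup>2 * (\<Sum>a\<in>A. \<Sum>b\<in>B. M a b * (\<Sum>k<d. u a k * v b k)) =
    F ?TX ?TY + F ?RX Y + F ?TX ?RY" .
  have R1: "\<bar>F ?RX Y\<bar> \<le> G * (q / 4 * q)"
    unfolding F_def
    by (rule hilbert_bound_scaled[OF G]) (use u v q sq rest in \<open>auto simp: X_def Y_def\<close>)
  have R2: "\<bar>F ?TX ?RY\<bar> \<le> G * (q * (q / 4))"
    unfolding F_def
    by (rule hilbert_bound_scaled[OF G]) (use u v q trunc rest in \<open>auto simp: X_def Y_def\<close>)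
  \<comment> \<open>With the sum over \<open>S\<close> outermost, each sign pattern contributes the
    bilinear form at numbers of absolute value at most 2.\<close>
  have "F ?TX ?TY = (\<Sum>a\<in>A. \<Sum>b\<in>B. \<Sum>S\<in>?\<Omega>. ?TX a S * M a b * ?TY b S)"
    unfolding F_def by (simp add: sum_distrib_left algebra_simps)
  also have "\<dots> = (\<Sum>a\<in>A. \<Sum>S\<in>?\<Omega>. \<Sum>b\<in>B. ?TX a S * M a b * ?TY b S)"
    by (subst sum.swap) (rule refl)
  also have "\<dots> = (\<Sum>S\<in>?\<Omega>. \<Sum>a\<in>A. \<Sum>b\<in>B. ?TX a S * M a b * ?TY b S)"
    by (rule sum.swap)
  also have "\<bar>\<dots>\<bar> \<le> (\<Sum>S\<in>?\<Omega>. \<bar>\<Sum>a\<in>A. \<Sum>b\<in>B. ?TX a S * M a b * ?TY b S\<bar>)"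
    by (rule sum_abs)
  also have "\<dots> \<le> (\<Sum>S\<in>?\<Omega>. 2 * 2 * ?N)"
    by (intro sum_mono abs_bilinear_le_norm_inf_1) (auto simp: abs_clamp2_le)
  also have "\<dots> = q\<^sup>2 * (4 * ?N)"
    by (simp add: card_Pow q)
  finally have "\<bar>F ?TX ?TY\<bar> \<le> q\<^sup>2 * (4 * ?N)" .
  with R1 R2 have "\<bar>q\<^sup>2 * (\<Sum>a\<in>A. \<Sum>b\<in>B. M a b * (\<Sum>k<d. u a k * v b k))\<bar> \<le>
      q\<^sup>2 * (4 * ?N + G / 2)"
    unfolding split by (simp add: power2_eq_square algebra_simps)
  then show "\<bar>\<Sum>a\<in>A. \<Sum>b\<in>B. M a b * (\<Sum>k<d. u a k * v b k)\<bar> \<le> 4 * ?N + G / 2"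
    using q by (simp add: abs_mult)
qed

text \<open>Cauchy-Schwarz. It provides some finite bound, so that the infimum of all bounds is
  meaningful.\<close>

lemma hilbert_bound_trivial: "hilbert_bound A B M (\<Sum>a\<in>A. \<Sum>b\<in>B. \<bar>M a b\<bar>)"
  unfolding hilbert_bound_def
proof (intro allI impI)
  fix d :: nat and u v
  assume u: "\<forall>a\<in>A. (\<Sum>k<d. (u a k)\<^sup>2) \<le> (1::real)"
    and v: "\<forall>b\<in>B. (\<Sum>k<d. (v b k)\<^sup>2) \<le> (1::real)"
  show "\<bar>\<Sum>a\<in>A. \<Sum>b\<in>B. M a b * (\<Sum>k<d. u a k * v b k)\<bar> \<le> (\<Sum>a\<in>A. \<Sum>b\<in>B. \<bar>M a b\<bar>)"
  proof (intro order_trans[OF sum_abs] sum_mono)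
    fix a b assume ab: "a \<in> A" "b \<in> B"
    have "(\<Sum>k<d. u a k * v b k)\<^sup>2 \<le> (\<Sum>k<d. (u a k)\<^sup>2) * (\<Sum>k<d. (v b k)\<^sup>2)"
      by (rule Cauchy_Schwarz_ineq_sum)
    also have "\<dots> \<le> 1 * 1"
      using u v ab by (intro mult_mono) (auto intro: sum_nonneg)
    finally have "\<bar>\<Sum>k<d. u a k * v b k\<bar> \<le> 1"
      by (simp add: abs_square_le_1)
    then show "\<bar>M a b * (\<Sum>k<d. u a k * v b k)\<bar> \<le> \<bar>M a b\<bar>"
      by (simp add: abs_mult mult_left_le)
  qed
qed

text \<open>The infimum of all bounds is itself a bound. Improving it cannot go below it, so G \<le>
  4 N + G / 2 for the best \<open>G\<close> and the norm N, which gives G \<le> 8 N.\<close>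

lemma hilbert_bound_8: "hilbert_bound A B M (8 * norm_inf_1 A B M)"
proof -
  define \<G> where "\<G> = {G. hilbert_bound A B M G}"
  have ne: "\<G> \<noteq> {}" using hilbert_bound_trivial by (auto simp: \<G>_def)
  \<comment> \<open>In dimension 0 the form vanishes.\<close>
  have pos: "G \<ge> 0" if "G \<in> \<G>" for G
    using that[unfolded \<G>_def hilbert_bound_def mem_Collect_eq, rule_format, where d = 0] by simp
  have bdd: "bdd_below \<G>" using pos by (rule bdd_belowI)
  have inf: "hilbert_bound A B M (Inf \<G>)"
    unfolding hilbert_bound_def
    by (intro allI impI cInf_greatest[OF ne]) (simp add: \<G>_def hilbert_bound_def)
  then have "4 * norm_inf_1 A B M + Inf \<G> / 2 \<in> \<G>"
    using hilbert_bound_improve by (auto simp: \<G>_def)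
  then have "Inf \<G> \<le> 4 * norm_inf_1 A B M + Inf \<G> / 2"
    using bdd by (intro cInf_lower)
  then have "Inf \<G> \<le> 8 * norm_inf_1 A B M" by simp
  with inf show ?thesis
    unfolding hilbert_bound_def by (meson order_trans)
qed

section \<open>The Grothendieck constant\<close>

lemma Grothendieck_bound_8: "Grothendieck_bound 8"
  unfolding Grothendieck_bound_def
proof (intro allI impI)
  fix m n d :: nat and M u v :: "nat \<Rightarrow> nat \<Rightarrow> real"
  assume "\<forall>i<m. (\<Sum>k<d. (u i k)\<^sup>2) = 1" "\<forall>j<n. (\<Sum>k<d. (v j k)\<^sup>2) = 1"
  then show "\<bar>\<Sum>i<m. \<Sum>j<n. M i j * (\<Sum>k<d. u i k * v j k)\<bar> \<le> 8 * norm_inf_1 {..<m} {..<n} M"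
    by (intro hilbert_bound_8[of "{..<m}" "{..<n}" M, unfolded hilbert_bound_def, rule_format]) auto
qed

text \<open>Tested on the 1 x 1 matrix with entry 1, where the form and the norm are both 1.\<close>

lemma Grothendieck_bound_ge_1:
  assumes "Grothendieck_bound K"
  shows "K \<ge> 1"
proof -
  have "norm_inf_1 {..<1::nat} {..<1::nat} (\<lambda>_ _. 1) = 1"
  proof (rule antisym)
    show "norm_inf_1 {..<1::nat} {..<1::nat} (\<lambda>_ _. 1) \<le> 1"
      unfolding norm_inf_1_def
    proof (rule cSup_least, goal_cases)
      case 1
      show ?case by (auto intro!: exI[of _ "\<lambda>_. 0"])
    next
      case (2 s)
      then obtain x y :: "nat \<Rightarrow> real" where "s = x 0 * y 0" "\<bar>x 0\<bar> \<le> 1" "\<bar>y 0\<bar> \<le> 1"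
        by auto
      then show ?case
        by (metis abs_ge_self abs_ge_zero abs_mult mult_le_one order_trans)
    qed
    show "1 \<le> norm_inf_1 {..<1::nat} {..<1::nat} (\<lambda>_ _. 1)"
      using norm_inf_1_upper[of "{..<1::nat}" "\<lambda>_. 1" "{..<1::nat}" "\<lambda>_. 1" "\<lambda>_ _. 1"] by simp
  qed
  then show ?thesis
    using assms[unfolded Grothendieck_bound_def, rule_format,
        where m = 1 and n = 1 and d = 1 and M = "\<lambda>_ _. 1" and u = "\<lambda>_ _. 1" and v = "\<lambda>_ _. 1"]
    by simp
qed

lemma K_G_ge_1: "K_G \<ge> 1"
  unfolding K_G_def using Grothendieck_bound_8 Grothendieck_bound_ge_1
  by (intro cInf_greatest) auto

text \<open>For fixed data the inequality survives passing to the infimum over \<open>K\<close>,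
  after division by the norm. If the norm is 0, the bound with constant 8 already makes the form
  vanish.\<close>

lemma Grothendieck_bound_K_G: "Grothendieck_bound K_G"
  unfolding Grothendieck_bound_def
proof (intro allI impI)
  fix m n d :: nat and M u v :: "nat \<Rightarrow> nat \<Rightarrow> real"
  assume u: "\<forall>i<m. (\<Sum>k<d. (u i k)\<^sup>2) = 1" and v: "\<forall>j<n. (\<Sum>k<d. (v j k)\<^sup>2) = 1"
  let ?F = "\<bar>\<Sum>i<m. \<Sum>j<n. M i j * (\<Sum>k<d. u i k * v j k)\<bar>" and ?N = "norm_inf_1 {..<m} {..<n} M"
  have *: "?F \<le> K * ?N" if "Grothendieck_bound K" for K
    using that u v unfolding Grothendieck_bound_def by blast
  show "?F \<le> K_G * ?N"
  proof (cases "?N = 0")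
    case True
    then show ?thesis using *[OF Grothendieck_bound_8] by simp
  next
    case False
    then have N: "?N > 0" using norm_inf_1_nonneg[of "{..<m}" "{..<n}" M] by simp
    have "?F / ?N \<le> K_G"
      unfolding K_G_def using Grothendieck_bound_8 * N
      by (intro cInf_greatest) (auto simp: divide_le_eq)
    then show ?thesis using N by (simp add: divide_le_eq)
  qed
qed

text \<open>Vectors of norm at most \<open>1\<close> are completed to unit vectors by two extra coordinates, one used
  by \<open>u\<close> and one by \<open>v\<close>, so that inner products do not change.\<close>

lemma hilbert_bound_K_G:
  assumes "finite A" "finite B"
  shows "hilbert_bound A B M (K_G * norm_inf_1 A B M)"
  unfolding hilbert_bound_def
proof (intro allI impI)
  fix d :: nat and u v
  assume u: "\<forall>a\<in>A. (\<Sum>k<d. (u a k)\<^sup>2) \<le> (1::real)"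
    and v: "\<forall>b\<in>B. (\<Sum>k<d. (v b k)\<^sup>2) \<le> (1::real)"
  obtain f g where f: "bij_betw f {..<card A} A" and g: "bij_betw g {..<card B} B"
    using assms by (metis ex_bij_betw_nat_finite atLeast0LessThan)
  have fA: "f i \<in> A" if "i < card A" for i using f that by (auto simp: bij_betw_def)
  have gB: "g j \<in> B" if "j < card B" for j using g that by (auto simp: bij_betw_def)
  let ?M = "\<lambda>i j. M (f i) (g j)"
  define u' where "u' i k = (if k < d then u (f i) k
    else if k = d then sqrt (1 - (\<Sum>k<d. (u (f i) k)\<^sup>2)) else 0)" for i k
  define v' where "v' j k = (if k < d then v (g j) k
    else if k = d then 0 else sqrt (1 - (\<Sum>k<d. (v (g j) k)\<^sup>2)))" for j k
  have "(\<Sum>k<Suc (Suc d). (u' i k)\<^sup>2) = 1" if "i < card A" for i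
    using u fA[OF that] by (simp add: u'_def)
  moreover have "(\<Sum>k<Suc (Suc d). (v' j k)\<^sup>2) = 1" if "j < card B" for j
    using v gB[OF that] by (simp add: v'_def)
  moreover have *: "(\<Sum>k<Suc (Suc d). u' i k * v' j k) = (\<Sum>k<d. u (f i) k * v (g j) k)" for i j
    by (simp add: u'_def v'_def)
  ultimately have "\<bar>\<Sum>i<card A. \<Sum>j<card B. ?M i j * (\<Sum>k<Suc (Suc d). u' i k * v' j k)\<bar>
      \<le> K_G * norm_inf_1 {..<card A} {..<card B} ?M"
    by (intro Grothendieck_bound_K_G[unfolded Grothendieck_bound_def, rule_format])
  also have "(\<Sum>i<card A. \<Sum>j<card B. ?M i j * (\<Sum>k<Suc (Suc d). u' i k * v' j k)) =
      (\<Sum>a\<in>A. \<Sum>b\<in>B. M a b * (\<Sum>k<d. u a k * v b k))"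
    unfolding *
    by (simp add: sum.reindex_bij_betw[OF f, symmetric] sum.reindex_bij_betw[OF g, symmetric])
  also have "K_G * norm_inf_1 {..<card A} {..<card B} ?M \<le> K_G * norm_inf_1 A B M"
    using K_G_ge_1 by (intro mult_left_mono norm_inf_1_reindex_le f g) auto
  finally show "\<bar>\<Sum>a\<in>A. \<Sum>b\<in>B. M a b * (\<Sum>k<d. u a k * v b k)\<bar> \<le> K_G * norm_inf_1 A B M" .
qed

section \<open>Duality for the semidefinite relaxation\<close>

text \<open>A line separates \<open>Q\<close> from the open negative quadrant. Points of the
  quadrant near the origin show that its threshold is nonnegative, distant points that its normal
  vector is. Scaling the normal vector to total mass 1 yields \<open>l\<close>.\<close>

lemma separating_weights_2:
  fixes Q :: "(real \<times> real) set"
  assumes Q: "convex Q" and neg: "\<And>x y. (x, y) \<in> Q \<Longrightarrow> x \<ge> 0 \<or> y \<ge> 0"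
  shows "\<exists>l\<ge>0. l \<le> 1 \<and> (\<forall>(x, y)\<in>Q. 0 \<le> (1 - l) * x + l * y)"
proof (cases "Q = {}")
  case True
  then show ?thesis by (intro exI[of _ 0]) auto
next
  case False
  let ?N = "{..<0::real} \<times> {..<0::real}"
  have "convex ?N" by (intro convex_Times convex_real_interval)
  moreover have "(-1, -1) \<in> ?N" by simp
  moreover have "?N \<inter> Q = {}" using neg by force
  ultimately obtain w b where w: "w \<noteq> 0" and N: "\<forall>z\<in>?N. inner w z \<le> b" and Qb: "\<forall>z\<in>Q. inner w z \<ge> b"
    using separating_hyperplane_sets[of ?N Q] Q False by blast
  obtain p q where pq: "w = (p, q)" by (cases w)
  have N': "- p * x - q * y \<le> b" if "x > 0" "y > 0" for x y
    using N[rule_format, of "(- x, - y)"] that by (simp add: pq)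
  have b: "b \<ge> 0"
  proof (rule ccontr)
    assume "\<not> b \<ge> 0"
    \<comment> \<open>The point \<open>(- e, - e)\<close> has value at least \<open>b / 2\<close>,
      which exceeds the negative \<open>b\<close>.\<close>
    define C where "C = 1 + \<bar>p\<bar> + \<bar>q\<bar>"
    define e where "e = - b / (2 * C)"
    have C: "C > 0" by (simp add: C_def add_pos_nonneg)
    then have e: "e > 0" using \<open>\<not> b \<ge> 0\<close> by (simp add: e_def divide_neg_pos)
    have "e * C = - b / 2"
      unfolding e_def using C by simp
    moreover have "e * (p + q) \<le> e * C"
      using e by (intro mult_left_mono) (auto simp: C_def)
    ultimately show False
      using N'[OF e e] \<open>\<not> b \<ge> 0\<close> by (simp add: algebra_simps)
  qed
  have p: "p \<ge> 0"
  proof (rule ccontr)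
    assume "\<not> p \<ge> 0"
    \<comment> \<open>The first product is \<open>b + \<bar>q\<bar> + 1\<close>, too large for the
      bound whatever the sign of \<open>q\<close>.\<close>
    moreover have "- p * ((b + \<bar>q\<bar> + 1) / - p) - q * 1 \<le> b"
      using calculation b by (intro N' divide_pos_pos) auto
    ultimately show False by simp
  qed
  have q: "q \<ge> 0"
  proof (rule ccontr)
    assume "\<not> q \<ge> 0"
    moreover have "- p * 1 - q * ((b + \<bar>p\<bar> + 1) / - q) \<le> b"
      using calculation b by (intro N' divide_pos_pos) auto
    ultimately show False by simp
  qed
  have s: "p + q > 0" using p q w by (auto simp: pq zero_prod_def)
  show ?thesis
  proof (intro exI[of _ "q / (p + q)"] conjI)
    show "\<forall>(x, y)\<in>Q. 0 \<le> (1 - q / (p + q)) * x + q / (p + q) * y"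
    proof clarify
      fix x y assume "(x, y) \<in> Q"
      then have "0 \<le> p * x + q * y" using Qb b by (force simp: pq)
      moreover have "1 - q / (p + q) = p / (p + q)"
        using s by (simp add: field_simps)
      then have "(1 - q / (p + q)) * x + q / (p + q) * y = (p * x + q * y) / (p + q)"
        by (simp add: add_divide_distrib)
      ultimately show "0 \<le> (1 - q / (p + q)) * x + q / (p + q) * y"
        using s by simp
    qed
  qed (use p q s in auto)
qed

text \<open>Two coordinates are merged into a convex combination of them; that some combination preserves
  the hypothesis is the planar case, applied to the members of \<open>P\<close> that are negative at all other
  coordinates.\<close>

lemma separating_weights:
  fixes P :: "('a \<Rightarrow> real) set"
  assumes "finite I" "I \<noteq> {}"
    and "\<And>p q s. p \<in> P \<Longrightarrow> q \<in> P \<Longrightarrow> 0 \<le> s \<Longrightarrow> s \<le> 1 \<Longrightarrow> (\<lambda>i. (1 - s) * p i + s * q i) \<in> P"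
    and "\<And>p. p \<in> P \<Longrightarrow> \<exists>i\<in>I. p i \<ge> 0"
  shows "\<exists>w. (\<forall>i\<in>I. w i \<ge> 0) \<and> sum w I = 1 \<and> (\<forall>p\<in>P. 0 \<le> (\<Sum>i\<in>I. w i * p i))"
  using assms
proof (induction I arbitrary: P rule: finite_ne_induct)
  case (singleton x)
  show ?case by (rule exI[of _ "\<lambda>_. 1"]) (use singleton in auto)
next
  case (insert k J)
  obtain j where j: "j \<in> J" using insert by auto
  define Q where "Q = (\<lambda>p. (p k, p j)) ` {p \<in> P. \<forall>i\<in>J - {j}. p i < 0}"
  have "convex Q"
    unfolding convex_alt
  proof (intro ballI allI impI)
    fix z z' and s :: real assume "z \<in> Q" "z' \<in> Q" and s: "0 \<le> s \<and> s \<le> 1"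
    then obtain p p' where p: "p \<in> P" "\<forall>i\<in>J - {j}. p i < 0" "z = (p k, p j)"
      and p': "p' \<in> P" "\<forall>i\<in>J - {j}. p' i < 0" "z' = (p' k, p' j)"
      by (auto simp: Q_def)
    have "(1 - s) * p i + s * p' i < 0" if "i \<in> J - {j}" for i
      using p(2) p'(2) s that convex_bound_lt[of "p i" 0 "p' i" "1 - s" s] by auto
    moreover have "(\<lambda>i. (1 - s) * p i + s * p' i) \<in> P"
      using s p p' by (intro insert.prems) auto
    ultimately show "(1 - s) *\<^sub>R z + s *\<^sub>R z' \<in> Q"
      unfolding Q_def p(3) p'(3)
      by (intro image_eqI[of _ _ "\<lambda>i. (1 - s) * p i + s * p' i"]) auto
  qed
  moreover have "x \<ge> 0 \<or> y \<ge> 0" if xy: "(x, y) \<in> Q" for x y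
  proof -
    obtain p where "p \<in> P" "\<forall>i\<in>J - {j}. p i < 0" "x = p k" "y = p j"
      using xy by (auto simp: Q_def)
    then show ?thesis using insert.prems(2)[of p] by force
  qed
  ultimately obtain l where l: "0 \<le> l" "l \<le> 1" and lQ: "\<forall>(x, y)\<in>Q. 0 \<le> (1 - l) * x + l * y"
    using separating_weights_2[of Q] by blast
  \<comment> \<open>\<open>m\<close> stores the merged coordinate at \<open>j\<close>, so that the
    induction hypothesis applies to \<open>J\<close>.\<close>
  define m where "m p = p(j := (1 - l) * p k + l * p j)" for p :: "'a \<Rightarrow> real"
  have "\<exists>w. (\<forall>i\<in>J. w i \<ge> 0) \<and> sum w J = 1 \<and> (\<forall>p\<in>m ` P. 0 \<le> (\<Sum>i\<in>J. w i * p i))"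
  proof (rule insert.IH)
    fix p q s assume "p \<in> m ` P" "q \<in> m ` P" and s: "0 \<le> s" "s \<le> (1::real)"
    then obtain p' q' where pq: "p' \<in> P" "q' \<in> P" "p = m p'" "q = m q'" by blast
    then have "(\<lambda>i. (1 - s) * p i + s * q i) = m (\<lambda>i. (1 - s) * p' i + s * q' i)"
      by (auto simp: m_def algebra_simps)
    moreover have "(\<lambda>i. (1 - s) * p' i + s * q' i) \<in> P"
      using s pq by (intro insert.prems) auto
    ultimately show "(\<lambda>i. (1 - s) * p i + s * q i) \<in> m ` P" by blast
  next
    fix p assume "p \<in> m ` P"
    then obtain p' where p': "p' \<in> P" "p = m p'" by blast
    show "\<exists>i\<in>J. p i \<ge> 0"
    proof (cases "\<exists>i\<in>J - {j}. p' i \<ge> 0")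
      case True
      then show ?thesis by (auto simp: p' m_def)
    next
      case False
      then have "(p' k, p' j) \<in> Q" using p' by (auto simp: Q_def not_le)
      then have "p j \<ge> 0" using lQ by (auto simp: p' m_def)
      with j show ?thesis by blast
    qed
  qed
  then obtain w where w: "\<forall>i\<in>J. w i \<ge> 0" "sum w J = 1"
    and wP: "\<forall>p\<in>P. 0 \<le> (\<Sum>i\<in>J. w i * m p i)"
    by blast
  \<comment> \<open>The weight of the merged coordinate is split between \<open>k\<close> and
    \<open>j\<close> in proportion \<open>1 - l\<close> to \<open>l\<close>.\<close>
  define w' where "w' = w(k := (1 - l) * w j, j := l * w j)"
  have kj: "k \<noteq> j" "k \<notin> J - {j}" using insert j by auto
  have split: "(\<Sum>i\<in>insert k J. h i) = h k + (h j + (\<Sum>i\<in>J - {j}. h i))" for h :: "'a \<Rightarrow> real"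
    using insert j by (simp add: sum.remove)
  have J: "(\<Sum>i\<in>J. h i) = h j + (\<Sum>i\<in>J - {j}. h i)" for h :: "'a \<Rightarrow> real"
    using insert j by (simp add: sum.remove)
  have w'w: "w' i = w i" if "i \<in> J - {j}" for i
    using that kj by (auto simp: w'_def)
  show ?case
  proof (intro exI[of _ w'] conjI ballI)
    show "w' i \<ge> 0" if "i \<in> insert k J" for i
      using that w l j by (auto simp: w'_def)
    show "sum w' (insert k J) = 1"
      using w(2) kj unfolding split J by (simp add: w'w) (simp add: w'_def algebra_simps)
    fix p assume "p \<in> P"
    then have "0 \<le> (\<Sum>i\<in>J. w i * m p i)" using wP by blast
    also have "\<dots> = (\<Sum>i\<in>insert k J. w' i * p i)"
      using kj unfolding split J by (simp add: w'w m_def) (simp add: w'_def algebra_simps)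
    finally show "0 \<le> (\<Sum>i\<in>insert k J. w' i * p i)" .
  qed
qed

text \<open>Weights are obtained by separation from the set of functions \<open>p zs\<close>. If
  such a function were negative everywhere, the vectors with coordinates \<open>z i\<close>, for
  \<open>z\<close> in \<open>zs\<close>, would violate the Hilbert space bound.\<close>

lemma hilbert_bound_dual:
  fixes M :: "'a \<Rightarrow> 'b \<Rightarrow> real"
  assumes fin: "finite A" "finite B" and ne: "A <+> B \<noteq> {}"
    and bound: "hilbert_bound A B M c"
  shows "\<exists>w. (\<forall>i\<in>A <+> B. w i \<ge> 0) \<and> sum w (A <+> B) = 1 \<and>
    (\<forall>z :: 'a + 'b \<Rightarrow> real. (\<Sum>a\<in>A. \<Sum>b\<in>B. M a b * (z (Inl a) * z (Inr b)))
        \<le> c * (\<Sum>i\<in>A <+> B. w i * (z i)\<^sup>2))"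
proof -
  let ?I = "A <+> B"
  define F where "F z = (\<Sum>a\<in>A. \<Sum>b\<in>B. M a b * (z (Inl a) * z (Inr b)))" for z :: "'a + 'b \<Rightarrow> real"
  \<comment> \<open>Lists of vectors make the range of \<open>p\<close> convex: concatenation adds
    the functions, and scaling a list by a square root scales its function.\<close>
  define p where "p zs i = (\<Sum>z\<leftarrow>zs. c * (z i)\<^sup>2 - F z)" for zs i
  have F_scale: "F (\<lambda>i. r * z i) = r\<^sup>2 * F z" for r z
    unfolding F_def by (simp add: sum_distrib_left power2_eq_square algebra_simps)
  have scale: "p (map (\<lambda>z i. r * z i) zs) i = r\<^sup>2 * p zs i" for r zs i
    unfolding p_def
    by (induction zs) (simp_all add: F_scale power_mult_distrib algebra_simps)
  have "\<exists>w. (\<forall>i\<in>?I. w i \<ge> 0) \<and> sum w ?I = 1 \<and> (\<forall>q\<in>range p. 0 \<le> (\<Sum>i\<in>?I. w i * q i))"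
  proof (rule separating_weights)
    fix q q' and s :: real assume "q \<in> range p" "q' \<in> range p" and s: "0 \<le> s" "s \<le> 1"
    then obtain zs zs' where q: "q = p zs" "q' = p zs'" by blast
    have "(\<lambda>i. (1 - s) * q i + s * q' i) =
        p (map (\<lambda>z i. sqrt (1 - s) * z i) zs @ map (\<lambda>z i. sqrt s * z i) zs')"
      using s scale[of "sqrt (1 - s)" zs] scale[of "sqrt s" zs']
      by (auto simp: q p_def)
    then show "(\<lambda>i. (1 - s) * q i + s * q' i) \<in> range p" by blast
  next
    fix q assume "q \<in> range p"
    then obtain zs where q: "q = p zs" by blast
    define d where "d = length zs"
    define N where "N i = (\<Sum>k<d. (zs ! k) i * (zs ! k) i)" for i
    have q': "q i = c * N i - (\<Sum>k<d. F (zs ! k))" for i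
      unfolding q p_def N_def d_def sum_list_sum_nth
      by (simp add: sum_subtractf sum_distrib_left power2_eq_square atLeast0LessThan)
    \<comment> \<open>\<open>N i\<close> is the squared length of the vector at index
      \<open>i\<close>; at a maximal one, all vectors lie in the ball of radius
      \<open>sqrt (N i)\<close>.\<close>
    have "Max (N ` ?I) \<in> N ` ?I"
      using fin ne by (intro Max_in) auto
    then obtain i where i: "i \<in> ?I" "Max (N ` ?I) = N i" by auto
    have N: "N j \<le> N i" if "j \<in> ?I" for j
      unfolding i(2)[symmetric] using fin that by (intro Max_ge) auto
    have Ni: "N i \<ge> 0" by (simp add: N_def sum_nonneg)
    have "(\<Sum>k<d. F (zs ! k)) = (\<Sum>a\<in>A. \<Sum>k<d. \<Sum>b\<in>B. M a b * ((zs ! k) (Inl a) * (zs ! k) (Inr b)))"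
      unfolding F_def by (rule sum.swap)
    also have "\<dots> = (\<Sum>a\<in>A. \<Sum>b\<in>B. M a b * (\<Sum>k<d. (zs ! k) (Inl a) * (zs ! k) (Inr b)))"
      unfolding sum_distrib_left by (intro sum.cong refl sum.swap)
    also have "\<dots> \<le> \<bar>\<dots>\<bar>" by simp
    also have "\<dots> \<le> c * (sqrt (N i) * sqrt (N i))"
      using Ni N by (intro hilbert_bound_scaled[OF bound]) (auto simp: N_def power2_eq_square)
    finally have "q i \<ge> 0" using Ni by (simp add: q')
    with i show "\<exists>i\<in>?I. q i \<ge> 0" by blast
  qed (use fin ne in auto)
  then obtain w where w: "\<forall>i\<in>?I. w i \<ge> 0" "sum w ?I = 1"
    and wp: "\<And>zs. 0 \<le> (\<Sum>i\<in>?I. w i * p zs i)" by blast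
  have "F z \<le> c * (\<Sum>i\<in>?I. w i * (z i)\<^sup>2)" for z
  proof -
    have "0 \<le> (\<Sum>i\<in>?I. w i * (c * (z i)\<^sup>2 - F z))"
      using wp[of "[z]"] by (simp add: p_def)
    also have "\<dots> = c * (\<Sum>i\<in>?I. w i * (z i)\<^sup>2) - sum w ?I * F z"
      by (simp add: sum_distrib_left sum_distrib_right algebra_simps sum_subtractf)
    finally show ?thesis by (simp add: w)
  qed
  with w show ?thesis unfolding F_def by blast
qed

text \<open>Completing the square, one variable at a time.\<close>

lemma psd_imp_sum_of_rank_one:
  fixes Q :: "'a \<Rightarrow> 'a \<Rightarrow> real"
  assumes "finite I" and "\<And>i j. Q i j = Q j i"
    and "\<And>z. 0 \<le> (\<Sum>i\<in>I. \<Sum>j\<in>I. Q i j * (z i * z j))"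
  shows "\<exists>L. \<forall>i\<in>I. \<forall>j\<in>I. Q i j = (\<Sum>l\<leftarrow>L. l i * l j)"
  using assms
proof (induction I arbitrary: Q rule: finite_induct)
  case empty
  show ?case by simp
next
  case (insert k I)
  have expand: "(\<Sum>i\<in>insert k I. \<Sum>j\<in>insert k I. Q i j * (z i * z j)) =
      Q k k * (z k)\<^sup>2 + 2 * z k * (\<Sum>i\<in>I. Q i k * z i) + (\<Sum>i\<in>I. \<Sum>j\<in>I. Q i j * (z i * z j))" for z
  proof -
    have "(\<Sum>j\<in>I. Q k j * (z k * z j)) = z k * (\<Sum>i\<in>I. Q i k * z i)"
      unfolding sum_distrib_left by (intro sum.cong refl) (simp add: insert.prems(1)[of k])
    moreover have "(\<Sum>i\<in>I. Q i k * (z i * z k)) = z k * (\<Sum>i\<in>I. Q i k * z i)"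
      unfolding sum_distrib_left by (intro sum.cong refl) simp
    ultimately show ?thesis
      using insert.hyps by (simp add: sum.distrib power2_eq_square)
  qed
  have upd: "(\<Sum>i\<in>I. Q i k * (z(k := x)) i) = (\<Sum>i\<in>I. Q i k * z i)"
    "(\<Sum>i\<in>I. \<Sum>j\<in>I. Q i j * ((z(k := x)) i * (z(k := x)) j)) = (\<Sum>i\<in>I. \<Sum>j\<in>I. Q i j * (z i * z j))"
    for z x
    using insert.hyps by (auto intro!: sum.cong)
  have form: "0 \<le> Q k k * x\<^sup>2 + 2 * x * (\<Sum>i\<in>I. Q i k * z i) + (\<Sum>i\<in>I. \<Sum>j\<in>I. Q i j * (z i * z j))"
    for x z
    using insert.prems(2)[of "z(k := x)"] unfolding expand upd by simp
  have Qkk: "Q k k \<ge> 0" using form[of 1 "\<lambda>_. 0"] by simp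
  \<comment> \<open>The Schur complement of the entry at \<open>k\<close>. If
    \<open>Q k k = 0\<close>, division by zero gives 0 and \<open>Q'\<close> is
    \<open>Q\<close>.\<close>
  define Q' where "Q' i j = Q i j - Q i k * Q j k / Q k k" for i j
  have rank1: "(\<Sum>i\<in>I. \<Sum>j\<in>I. Q i k * Q j k / Q k k * (z i * z j)) = (\<Sum>i\<in>I. Q i k * z i)\<^sup>2 / Q k k"
    for z
    by (simp add: power2_eq_square sum_product sum_divide_distrib algebra_simps)
  have Q'_eq: "(\<Sum>i\<in>I. \<Sum>j\<in>I. Q' i j * (z i * z j)) =
      (\<Sum>i\<in>I. \<Sum>j\<in>I. Q i j * (z i * z j)) - (\<Sum>i\<in>I. Q i k * z i)\<^sup>2 / Q k k" for z
    unfolding Q'_def left_diff_distrib sum_subtractf rank1 ..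
  have "\<exists>L. \<forall>i\<in>I. \<forall>j\<in>I. Q' i j = (\<Sum>l\<leftarrow>L. l i * l j)"
  proof (rule insert.IH)
    show "Q' i j = Q' j i" for i j
      by (simp add: Q'_def insert.prems(1)[of i j] mult.commute)
    fix z
    show "0 \<le> (\<Sum>i\<in>I. \<Sum>j\<in>I. Q' i j * (z i * z j))"
      \<comment> \<open>The chosen value at \<open>k\<close> minimises the form when
        \<open>Q k k > 0\<close>.\<close>
      using form[of "- (\<Sum>i\<in>I. Q i k * z i) / Q k k" z] unfolding Q'_eq
      by (cases "Q k k = 0") (simp_all add: power2_eq_square)
  qed
  then obtain L where L: "\<forall>i\<in>I. \<forall>j\<in>I. Q' i j = (\<Sum>l\<leftarrow>L. l i * l j)" by blast
  \<comment> \<open>With a zero diagonal entry the form is affine in the coordinate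
    \<open>x\<close>, so a nonzero slope would make it negative somewhere.\<close>
  have zero: "Q i k = 0" if "i \<in> I" "Q k k = 0" for i
  proof (rule ccontr)
    assume nz: "Q i k \<noteq> 0"
    let ?z = "\<lambda>j. if j = i then 1 else 0 :: real"
    have 1: "(\<Sum>i\<in>I. Q i k * ?z i) = Q i k"
      using insert.hyps that by (simp add: if_distrib sum.delta cong: if_cong)
    define R where "R = (\<Sum>i\<in>I. \<Sum>j\<in>I. Q i j * (?z i * ?z j))"
    have "0 \<le> 2 * x * Q i k + R" for x
      using form[of x ?z] unfolding 1 R_def that(2) by simp
    from this[of "- (R + 1) / (2 * Q i k)"] nz show False
      by (simp add: field_simps)
  qed
  define l0 where "l0 = (\<lambda>i. Q i k / sqrt (Q k k))"
  \<comment> \<open>\<open>L\<close> is controlled on \<open>I\<close> only, so its members are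
    reset to 0 at \<open>k\<close>; row and column \<open>k\<close> come from \<open>l0\<close>
    alone.\<close>
  let ?L = "l0 # map (\<lambda>l. l(k := 0)) L"
  have "Q i j = (\<Sum>l\<leftarrow>?L. l i * l j)" if "i \<in> insert k I" "j \<in> insert k I" for i j
  proof (cases "i = k \<or> j = k")
    case True
    then have "Q i j = l0 i * l0 j"
      using Qkk zero that insert.prems(1)[of i j] by (cases "Q k k = 0") (auto simp: l0_def)
    moreover have "(\<Sum>l\<leftarrow>L. (l(k := 0)) i * (l(k := 0)) j) = 0"
      using True by (intro sum_list_0[THEN trans[rotated]] arg_cong[where f = sum_list] map_cong) auto
    ultimately show ?thesis by (simp add: comp_def)
  next
    case False
    then have "Q' i j = (\<Sum>l\<leftarrow>L. l i * l j)" using L that by blast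
    with False Qkk show ?thesis
      by (simp add: comp_def Q'_def l0_def)
  qed
  then show ?case by blast
qed

section \<open>Calculus of sum-of-squares proofs\<close>

lemma rconst_0 [simp]: "rconst 0 = 0"
  and rconst_1 [simp]: "rconst 1 = 1"
  by (simp_all add: rconst_def)

lemma rconst_add: "rconst (a + b) = rconst a + rconst b"
  by (simp add: rconst_def single_add)

lemma rconst_mult: "rconst (a * b) = rconst a * rconst b"
  by (simp add: rconst_def mult_single)

lemma rconst_sum: "rconst (\<Sum>i\<in>I. f i) = (\<Sum>i\<in>I. rconst (f i))"
  by (induction I rule: infinite_finite_induct) (simp_all add: rconst_add)

section \<open>Bounds on degrees and variables\<close>

lemma degree_le_mono: "degree_le d p \<Longrightarrow> d \<le> e \<Longrightarrow> degree_le e p"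
  unfolding degree_le_def by force

lemma degree_le_0 [simp]: "degree_le d 0"
  by (simp add: degree_le_def)

lemma degree_le_rconst [simp]: "degree_le d (rconst c)"
  by (simp add: degree_le_def rconst_def)

lemma degree_le_1 [simp]: "degree_le d 1"
  using degree_le_rconst[of d 1] by simp

lemma degree_le_rvar: "degree_le 1 (rvar i)"
  by (simp add: degree_le_def rvar_def)

lemma degree_le_add: "degree_le d p \<Longrightarrow> degree_le d q \<Longrightarrow> degree_le d (p + q)"
  unfolding degree_le_def using keys_add[of p q] by blast

lemma degree_le_uminus: "degree_le d p \<Longrightarrow> degree_le d (- p)"
  by (simp add: degree_le_def)

lemma degree_le_diff: "degree_le d p \<Longrightarrow> degree_le d q \<Longrightarrow> degree_le d (p - q)"
  using degree_le_add[of d p "- q"] degree_le_uminus[of d q] by simp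

lemma degree_le_sum: "(\<And>i. i \<in> I \<Longrightarrow> degree_le d (f i)) \<Longrightarrow> degree_le d (\<Sum>i\<in>I. f i)"
  by (induction I rule: infinite_finite_induct) (simp_all add: degree_le_add)

lemma degree_le_sum_list: "(\<And>i. i \<in> set xs \<Longrightarrow> degree_le d (f i)) \<Longrightarrow> degree_le d (\<Sum>i\<leftarrow>xs. f i)"
  by (induction xs) (simp_all add: degree_le_add)

lemma degree_le_mult:
  assumes "degree_le d p" "degree_le e q"
  shows "degree_le (d + e) (p * q)"
  unfolding degree_le_def
proof
  fix m assume "m \<in> Poly_Mapping.keys (p * q)"
  then obtain a b where m: "m = a + b" and ab: "a \<in> Poly_Mapping.keys p" "b \<in> Poly_Mapping.keys q"
    using keys_mult[of p q] by blast
  have "(\<Sum>i\<in>Poly_Mapping.keys m. Poly_Mapping.lookup m i) =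
      (\<Sum>i\<in>Poly_Mapping.keys a. Poly_Mapping.lookup a i) + (\<Sum>i\<in>Poly_Mapping.keys b. Poly_Mapping.lookup b i)"
    unfolding m by (rule setsum_keys_plus_distrib) auto
  also have "\<dots> \<le> d + e"
    using assms ab by (intro add_mono) (auto simp: degree_le_def)
  finally show "(\<Sum>i\<in>Poly_Mapping.keys m. Poly_Mapping.lookup m i) \<le> d + e" .
qed

lemma degree_le_rconst_mult: "degree_le d p \<Longrightarrow> degree_le d (rconst c * p)"
  using degree_le_mult[OF degree_le_rconst[of 0 c]] by simp

lemma degree_le_square: "degree_le d p \<Longrightarrow> degree_le (2 * d) (p\<^sup>2)"
  using degree_le_mult[of d p d p] by (simp add: power2_eq_square mult_2)

lemma vars_in_0 [simp]: "vars_in V 0"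
  by (simp add: vars_in_def)

lemma vars_in_rconst [simp]: "vars_in V (rconst c)"
  by (simp add: vars_in_def rconst_def)

lemma vars_in_1 [simp]: "vars_in V 1"
  using vars_in_rconst[of V 1] by simp

lemma vars_in_rvar: "i \<in> V \<Longrightarrow> vars_in V (rvar i)"
  by (simp add: vars_in_def rvar_def)

lemma vars_in_add: "vars_in V p \<Longrightarrow> vars_in V q \<Longrightarrow> vars_in V (p + q)"
  unfolding vars_in_def using keys_add[of p q] by blast

lemma vars_in_sum: "(\<And>i. i \<in> I \<Longrightarrow> vars_in V (f i)) \<Longrightarrow> vars_in V (\<Sum>i\<in>I. f i)"
  by (induction I rule: infinite_finite_induct) (simp_all add: vars_in_add)

lemma vars_in_mult:
  assumes "vars_in V p" "vars_in V q"
  shows "vars_in V (p * q)"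
  unfolding vars_in_def
proof
  fix m assume "m \<in> Poly_Mapping.keys (p * q)"
  then obtain a b where "m = a + b" "a \<in> Poly_Mapping.keys p" "b \<in> Poly_Mapping.keys q"
    using keys_mult[of p q] by blast
  then show "Poly_Mapping.keys m \<subseteq> V"
    using assms keys_add[of a b] unfolding vars_in_def by blast
qed

section \<open>Closure properties of sums of squares and of proofs\<close>

lemma is_sos_0: "is_sos V 0"
  unfolding is_sos_def by (rule exI[of _ "[]"]) simp

lemma is_sos_square: "vars_in V q \<Longrightarrow> is_sos V (q\<^sup>2)"
  unfolding is_sos_def by (rule exI[of _ "[q]"]) simp

lemma is_sos_add:
  assumes "is_sos V p" "is_sos V q"
  shows "is_sos V (p + q)"
proof -
  obtain ps qs where "\<forall>q \<in> set ps. vars_in V q" "p = (\<Sum>q\<leftarrow>ps. q\<^sup>2)"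
    "\<forall>q \<in> set qs. vars_in V q" "q = (\<Sum>q\<leftarrow>qs. q\<^sup>2)"
    using assms unfolding is_sos_def by blast
  then show ?thesis
    unfolding is_sos_def by (intro exI[of _ "ps @ qs"]) auto
qed

lemma is_sos_square_mult:
  assumes "vars_in V h" "is_sos V p"
  shows "is_sos V (h\<^sup>2 * p)"
proof -
  obtain ps where ps: "\<forall>q \<in> set ps. vars_in V q" "p = (\<Sum>q\<leftarrow>ps. q\<^sup>2)"
    using assms unfolding is_sos_def by blast
  have "h\<^sup>2 * p = (\<Sum>q\<leftarrow>map (\<lambda>q. h * q) ps. q\<^sup>2)"
    by (simp add: ps(2) comp_def power_mult_distrib sum_list_const_mult)
  with ps(1) assms(1) show ?thesis
    unfolding is_sos_def by (intro exI[of _ "map (\<lambda>q. h * q) ps"]) (auto intro: vars_in_mult)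
qed

text \<open>Reduces the calculus to proofs of nonnegativity.\<close>

lemma sos_proves_iff_diff: "sos_proves V I g d p q \<longleftrightarrow> sos_proves V I g d 0 (q - p)"
  by (simp add: sos_proves_def)

lemma sos_proves_sos:
  assumes "finite I" "is_sos V p" "degree_le d p"
  shows "sos_proves V I g d 0 p"
  unfolding sos_proves_def
  using assms is_sos_0 by (intro conjI exI[of _ p] exI[of _ "\<lambda>_. 0"]) auto

lemma sos_proves_axiom:
  assumes "finite I" "i \<in> I" "degree_le d (g i)"
  shows "sos_proves V I g d 0 (g i)"
proof -
  have "is_sos V 1" using is_sos_square[of V 1] by simp
  moreover have "(\<Sum>j\<in>I. (if j = i then 1 else 0) * g j) = g i"
    using assms by (simp add: if_distrib[of "\<lambda>x. x * _"] sum.delta cong: if_cong)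
  ultimately show ?thesis
    unfolding sos_proves_def
    using assms is_sos_0 by (intro conjI exI[of _ 0] exI[of _ "\<lambda>j. if j = i then 1 else 0"]) auto
qed

lemma sos_proves_add:
  assumes "sos_proves V I g d 0 p" "sos_proves V I g d 0 q"
  shows "sos_proves V I g d 0 (p + q)"
proof -
  obtain s0 s where s: "is_sos V s0" "\<forall>i\<in>I. is_sos V (s i)" "p = s0 + (\<Sum>i\<in>I. s i * g i)"
    "degree_le d s0" "\<forall>i\<in>I. degree_le d (s i * g i)"
    using assms(1) unfolding sos_proves_def by auto
  obtain r0 r where r: "is_sos V r0" "\<forall>i\<in>I. is_sos V (r i)" "q = r0 + (\<Sum>i\<in>I. r i * g i)"
    "degree_le d r0" "\<forall>i\<in>I. degree_le d (r i * g i)"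
    using assms(2) unfolding sos_proves_def by auto
  show ?thesis
    unfolding sos_proves_def
  proof (intro conjI exI[of _ "s0 + r0"] exI[of _ "\<lambda>i. s i + r i"])
    show "finite I" using assms(1) by (simp add: sos_proves_def)
    show "p + q - 0 = s0 + r0 + (\<Sum>i\<in>I. (s i + r i) * g i)"
      by (simp add: s(3) r(3) distrib_right sum.distrib)
  qed (use s r in \<open>auto simp: distrib_right intro!: is_sos_add degree_le_add\<close>)
qed

lemma sos_proves_square_mult:
  assumes h: "vars_in V h" "degree_le e h" and p: "sos_proves V I g d 0 p"
  shows "sos_proves V I g (2 * e + d) 0 (h\<^sup>2 * p)"
proof -
  obtain s0 s where s: "is_sos V s0" "\<forall>i\<in>I. is_sos V (s i)" "p = s0 + (\<Sum>i\<in>I. s i * g i)"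
    "degree_le d s0" "\<forall>i\<in>I. degree_le d (s i * g i)"
    using p unfolding sos_proves_def by auto
  show ?thesis
    unfolding sos_proves_def
  proof (intro conjI exI[of _ "h\<^sup>2 * s0"] exI[of _ "\<lambda>i. h\<^sup>2 * s i"])
    show "finite I" using p by (simp add: sos_proves_def)
    show "h\<^sup>2 * p - 0 = h\<^sup>2 * s0 + (\<Sum>i\<in>I. h\<^sup>2 * s i * g i)"
      by (simp add: s(3) distrib_left sum_distrib_left mult.assoc)
  qed (use s h in \<open>auto simp: mult.assoc intro!: is_sos_square_mult degree_le_mult degree_le_square\<close>)
qed

lemma sos_proves_rconst_mult:
  assumes "c \<ge> 0" "sos_proves V I g d 0 p"
  shows "sos_proves V I g d 0 (rconst c * p)"
  \<comment> \<open>\<open>c\<close> is the square of the constant \<open>sqrt c\<close>, which has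
    degree 0, so the degree of the proof does not grow.\<close>
  using sos_proves_square_mult[OF vars_in_rconst[of V "sqrt c"] degree_le_rconst[of 0] assms(2)] assms(1)
  by (simp add: power2_eq_square flip: rconst_mult)

lemma sos_proves_sum:
  assumes "finite I" "\<And>j. j \<in> J \<Longrightarrow> sos_proves V I g d 0 (p j)"
  shows "sos_proves V I g d 0 (\<Sum>j\<in>J. p j)"
  using assms(2)
  by (induction J rule: infinite_finite_induct)
    (simp_all add: sos_proves_add sos_proves_sos[OF assms(1) is_sos_0])

lemma sos_proves_mono:
  "sos_proves V I g d p q \<Longrightarrow> d \<le> e \<Longrightarrow> sos_proves V I g e p q"
  unfolding sos_proves_def by (meson degree_le_mono)

section \<open>Monomials of tuples\<close>

lemma tuple_monom_Nil [simp]: "tuple_monom [] = 1"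
  and tuple_monom_Cons [simp]: "tuple_monom (i # \<alpha>) = rvar i * tuple_monom \<alpha>"
  and tuple_monom_append: "tuple_monom (\<beta> @ \<gamma>) = tuple_monom \<beta> * tuple_monom \<gamma>"
  by (simp_all add: tuple_monom_def)

lemma degree_le_tuple_monom: "degree_le (length \<alpha>) (tuple_monom \<alpha>)"
proof (induction \<alpha>)
  case (Cons i \<alpha>)
  show ?case using degree_le_mult[OF degree_le_rvar[of i] Cons] by simp
qed simp

lemma vars_in_tuple_monom: "set \<alpha> \<subseteq> V \<Longrightarrow> vars_in V (tuple_monom \<alpha>)"
  by (induction \<alpha>) (simp_all add: vars_in_mult vars_in_rvar)

text \<open>Telescoping by 1 - x^2 z^2 = (1 - x^2) + x^2 (1 - z^2), at the cost of degree 2 for each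
  further variable x.\<close>

lemma sos_proves_tuple_monom_square_le_1:
  assumes W: "finite W" and "set \<alpha> \<subseteq> W"
  shows "sos_proves W W (\<lambda>i. 1 - (rvar i)\<^sup>2) (2 * length \<alpha>) 0 (1 - (tuple_monom \<alpha>)\<^sup>2)"
  using assms(2)
proof (induction \<alpha>)
  case Nil
  show ?case using sos_proves_sos[OF W is_sos_0] by simp
next
  case (Cons i \<alpha>)
  have "degree_le 2 (1 - (rvar i)\<^sup>2)"
    using degree_le_square[OF degree_le_rvar[of i]] by (simp add: degree_le_diff)
  then have "sos_proves W W (\<lambda>i. 1 - (rvar i)\<^sup>2) 2 0 (1 - (rvar i)\<^sup>2)"
    using sos_proves_axiom[of W i 2 "\<lambda>i. 1 - (rvar i)\<^sup>2"] W Cons.prems by simp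
  then have "sos_proves W W (\<lambda>i. 1 - (rvar i)\<^sup>2) (2 * length (i # \<alpha>)) 0 (1 - (rvar i)\<^sup>2)"
    by (rule sos_proves_mono) simp
  moreover have "sos_proves W W (\<lambda>i. 1 - (rvar i)\<^sup>2) (2 * length (i # \<alpha>)) 0
      ((rvar i)\<^sup>2 * (1 - (tuple_monom \<alpha>)\<^sup>2))"
    using sos_proves_square_mult[OF vars_in_rvar degree_le_rvar Cons.IH] Cons.prems by simp
  ultimately have "sos_proves W W (\<lambda>i. 1 - (rvar i)\<^sup>2) (2 * length (i # \<alpha>)) 0
      (1 - (rvar i)\<^sup>2 + (rvar i)\<^sup>2 * (1 - (tuple_monom \<alpha>)\<^sup>2))"
    by (rule sos_proves_add)
  then show ?case
    by (simp add: algebra_simps power_mult_distrib)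
qed

section \<open>The certificate\<close>

lemma finite_tuples: "finite W \<Longrightarrow> finite (tuples W n)"
  unfolding tuples_def by (rule finite_lists_length_eq)

lemma sum_tuples_append:
  fixes f :: "'w list \<Rightarrow> 'c::comm_monoid_add"
  shows "(\<Sum>\<alpha>\<in>tuples W (m + n). f \<alpha>) = (\<Sum>\<beta>\<in>tuples W m. \<Sum>\<gamma>\<in>tuples W n. f (\<beta> @ \<gamma>))"
proof -
  have "bij_betw (\<lambda>(\<beta>, \<gamma>). \<beta> @ \<gamma>) (tuples W m \<times> tuples W n) (tuples W (m + n))"
    by (rule bij_betw_byWitness[where f' = "\<lambda>\<alpha>. (take m \<alpha>, drop m \<alpha>)"])
      (auto simp: tuples_def dest: in_set_takeD in_set_dropD)
  from sum.reindex_bij_betw[OF this, of f] show ?thesis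
    by (simp add: sum.cartesian_product case_prod_unfold)
qed

text \<open>The third block is summed with \<open>a\<close> outermost, to be merged term by term
  with the second.\<close>

lemma sum_Plus_Plus:
  fixes f :: "'a + 'b \<Rightarrow> 'a + 'b \<Rightarrow> 'c::comm_monoid_add"
  assumes "finite A" "finite B"
  shows "(\<Sum>i\<in>A <+> B. \<Sum>j\<in>A <+> B. f i j) =
    ((\<Sum>a\<in>A. \<Sum>a'\<in>A. f (Inl a) (Inl a')) + (\<Sum>a\<in>A. \<Sum>b\<in>B. f (Inl a) (Inr b))) +
    ((\<Sum>a\<in>A. \<Sum>b\<in>B. f (Inr b) (Inl a)) + (\<Sum>b\<in>B. \<Sum>b'\<in>B. f (Inr b) (Inr b')))"
  using assms sum.swap[of "\<lambda>b a. f (Inr b) (Inl a)" A B]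
  by (simp add: sum.Plus sum.distrib ac_simps)

text \<open>\<open>Q\<close> is the symmetric matrix of the form on the right, each entry of
  \<open>M\<close> being halved between the two off-diagonal blocks. The map \<phi> lets one
  computation serve real vectors (the identity) and polynomials (\<open>rconst\<close>).\<close>

lemma sum_bilinear_symmetrized:
  fixes \<phi> :: "real \<Rightarrow> 'r::comm_ring_1" and M :: "'a \<Rightarrow> 'b \<Rightarrow> real" and X :: "'a + 'b \<Rightarrow> 'r"
  assumes fin: "finite A" "finite B"
    and add: "\<And>x y. \<phi> (x + y) = \<phi> x + \<phi> y" and mult: "\<And>x y. \<phi> (x * y) = \<phi> x * \<phi> y"
    and Q: "\<And>i j. Q i j = (if i = j then c * w i else 0) -
      (case (i, j) of (Inl a, Inr b) \<Rightarrow> M a b | (Inr b, Inl a) \<Rightarrow> M a b | _ \<Rightarrow> 0) / 2"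
  shows "(\<Sum>i\<in>A <+> B. \<Sum>j\<in>A <+> B. \<phi> (Q i j) * (X i * X j)) =
    \<phi> c * (\<Sum>i\<in>A <+> B. \<phi> (w i) * (X i)\<^sup>2)
      - (\<Sum>a\<in>A. \<Sum>b\<in>B. \<phi> (M a b) * (X (Inl a) * X (Inr b)))"
proof -
  let ?I = "A <+> B"
  let ?D = "\<lambda>i j. if i = j then c * w i else 0"
  let ?N = "\<lambda>i j. (case (i, j) of (Inl a, Inr b) \<Rightarrow> M a b | (Inr b, Inl a) \<Rightarrow> M a b | _ \<Rightarrow> 0) / 2"
  have zero: "\<phi> 0 = 0" using add[of 0 0] by simp
  have diff: "\<phi> (x - y) = \<phi> x - \<phi> y" for x y
    using add[of "x - y" y] by (simp add: algebra_simps)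
  have half: "\<phi> (x / 2) + \<phi> (x / 2) = \<phi> x" for x
    by (simp flip: add)
  have "(\<Sum>i\<in>?I. \<Sum>j\<in>?I. \<phi> (Q i j) * (X i * X j)) =
      (\<Sum>i\<in>?I. \<Sum>j\<in>?I. \<phi> (?D i j) * (X i * X j)) - (\<Sum>i\<in>?I. \<Sum>j\<in>?I. \<phi> (?N i j) * (X i * X j))"
    unfolding Q diff left_diff_distrib sum_subtractf ..
  also have "(\<Sum>i\<in>?I. \<Sum>j\<in>?I. \<phi> (?D i j) * (X i * X j)) = \<phi> c * (\<Sum>i\<in>?I. \<phi> (w i) * (X i)\<^sup>2)"
  proof -
    have "(\<Sum>j\<in>?I. \<phi> (?D i j) * (X i * X j)) = \<phi> c * (\<phi> (w i) * (X i)\<^sup>2)" if "i \<in> ?I" for i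
    proof -
      have "(\<Sum>j\<in>?I. \<phi> (?D i j) * (X i * X j)) =
          (\<Sum>j\<in>?I. if i = j then \<phi> (c * w i) * (X i * X i) else 0)"
        by (rule sum.cong) (auto simp: zero)
      then show ?thesis
        using fin that by (simp add: mult power2_eq_square mult.assoc)
    qed
    then show ?thesis by (simp add: sum_distrib_left)
  qed
  also have "(\<Sum>i\<in>?I. \<Sum>j\<in>?I. \<phi> (?N i j) * (X i * X j)) =
      (\<Sum>a\<in>A. \<Sum>b\<in>B. \<phi> (M a b) * (X (Inl a) * X (Inr b)))"
    unfolding sum_Plus_Plus[OF fin]
    by (simp add: zero mult.commute[of "X (Inr _)" "X (Inl _)"] half flip: sum.distrib distrib_right)
  finally show ?thesis .
qed

lemma sum_rank_one_eq_sum_squares: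
  "(\<Sum>i\<in>I. \<Sum>j\<in>I. rconst (\<Sum>l\<leftarrow>L. l i * l j) * (X i * X j)) =
    (\<Sum>l\<leftarrow>L. (\<Sum>i\<in>I. rconst (l i) * X i)\<^sup>2)"
proof (induction L)
  case (Cons l L)
  have "(\<Sum>i\<in>I. \<Sum>j\<in>I. rconst (l i * l j) * (X i * X j)) = (\<Sum>i\<in>I. rconst (l i) * X i)\<^sup>2"
    by (simp add: power2_eq_square sum_product rconst_mult ac_simps)
  with Cons show ?case
    by (simp add: rconst_add distrib_right sum.distrib)
qed simp

text \<open>Semidefiniteness over real vectors decomposes the coefficient matrix into rank-one
  matrices; this matrix identity then applies to the polynomials \<open>X i\<close>.\<close>

lemma weighted_squares_minus_bilinear_sos:
  fixes M :: "'a \<Rightarrow> 'b \<Rightarrow> real" and X :: "'a + 'b \<Rightarrow> 'v rpoly"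
  assumes fin: "finite A" "finite B"
    and psd: "\<And>z. (\<Sum>a\<in>A. \<Sum>b\<in>B. M a b * (z (Inl a) * z (Inr b))) \<le> c * (\<Sum>i\<in>A <+> B. w i * (z i)\<^sup>2)"
  shows "\<exists>L. rconst c * (\<Sum>i\<in>A <+> B. rconst (w i) * (X i)\<^sup>2)
      - (\<Sum>a\<in>A. \<Sum>b\<in>B. rconst (M a b) * (X (Inl a) * X (Inr b)))
    = (\<Sum>l\<leftarrow>L. (\<Sum>i\<in>A <+> B. rconst (l i) * X i)\<^sup>2)"
proof -
  define Q where "Q i j = (if i = j then c * w i else 0) -
      (case (i, j) of (Inl a, Inr b) \<Rightarrow> M a b | (Inr b, Inl a) \<Rightarrow> M a b | _ \<Rightarrow> 0) / 2" for i j
  have "\<exists>L. \<forall>i\<in>A <+> B. \<forall>j\<in>A <+> B. Q i j = (\<Sum>l\<leftarrow>L. l i * l j)"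
  proof (rule psd_imp_sum_of_rank_one)
    show "Q i j = Q j i" for i j
      by (auto simp: Q_def split: sum.splits)
    show "0 \<le> (\<Sum>i\<in>A <+> B. \<Sum>j\<in>A <+> B. Q i j * (z i * z j))" for z
      using psd[of z] sum_bilinear_symmetrized[OF fin, of "\<lambda>x. x" Q c w M z] by (simp add: Q_def)
  qed (use fin in auto)
  then obtain L where L: "\<forall>i\<in>A <+> B. \<forall>j\<in>A <+> B. Q i j = (\<Sum>l\<leftarrow>L. l i * l j)" by blast
  have "(\<Sum>i\<in>A <+> B. \<Sum>j\<in>A <+> B. rconst (Q i j) * (X i * X j)) =
      (\<Sum>l\<leftarrow>L. (\<Sum>i\<in>A <+> B. rconst (l i) * X i)\<^sup>2)"
    unfolding sum_rank_one_eq_sum_squares[symmetric] using L by (intro sum.cong refl) auto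
  moreover note sum_bilinear_symmetrized[OF fin, of rconst Q c w M X, OF rconst_add rconst_mult Q_def]
  ultimately show ?thesis by auto
qed

text \<open>Since \<open>m \<le> n\<close>, row and column monomials have degree at most
  \<open>n\<close>, so all squares in the certificate stay within degree
  \<open>2 * n\<close>.\<close>

lemma sos_proves_flattening_bound:
  fixes W :: "'w set" and T :: "'w list \<Rightarrow> real"
  assumes W: "finite W" and mn: "m \<le> n"
  shows "sos_proves W W (\<lambda>i. 1 - (rvar i)\<^sup>2) (2 * n)
           (\<Sum>\<alpha>\<in>tuples W (m + n). rconst (T \<alpha>) * tuple_monom \<alpha>)
           (rconst (K_G * norm_inf_1 (tuples W m) (tuples W n) (flattening T)))"
proof -
  let ?A = "tuples W m" and ?B = "tuples W n" and ?M = "flattening T"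
  let ?I = "?A <+> ?B"
  let ?P = "sos_proves W W (\<lambda>i. 1 - (rvar i)\<^sup>2) (2 * n) 0 :: 'w rpoly \<Rightarrow> bool"
  define c where "c = K_G * norm_inf_1 ?A ?B ?M"
  have c: "c \<ge> 0" using K_G_ge_1 norm_inf_1_nonneg[of ?A ?B ?M] by (simp add: c_def)
  note fin = finite_tuples[OF W, of m] finite_tuples[OF W, of n]
  have sum_eq: "(\<Sum>\<alpha>\<in>tuples W (m + n). rconst (T \<alpha>) * tuple_monom \<alpha>) =
      (\<Sum>\<beta>\<in>?A. \<Sum>\<gamma>\<in>?B. rconst (?M \<beta> \<gamma>) * (tuple_monom \<beta> * tuple_monom \<gamma>))"
    by (simp add: sum_tuples_append flattening_def tuple_monom_append)
  have "?P (rconst c - (\<Sum>\<beta>\<in>?A. \<Sum>\<gamma>\<in>?B. rconst (?M \<beta> \<gamma>) * (tuple_monom \<beta> * tuple_monom \<gamma>)))"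
  proof (cases "?I = {}")
    case True
    \<comment> \<open>No weights of total mass 1 exist on an empty index set, but then both sides of
      the claim are 0.\<close>
    then have "c = 0" by (simp add: c_def norm_inf_1_def)
    with True show ?thesis using sos_proves_sos[OF W is_sos_0] by simp
  next
    case False
    obtain w where w: "\<forall>i\<in>?I. w i \<ge> 0" "sum w ?I = 1"
      and dual: "\<And>z :: 'w list + 'w list \<Rightarrow> real.
        (\<Sum>a\<in>?A. \<Sum>b\<in>?B. ?M a b * (z (Inl a) * z (Inr b))) \<le> c * (\<Sum>i\<in>?I. w i * (z i)\<^sup>2)"
      using hilbert_bound_dual[OF fin False hilbert_bound_K_G[OF fin, of ?M]] unfolding c_def by blast
    \<comment> \<open>The disjoint sum keeps rows and columns apart even when \<open>m = n\<close>
      and the same tuples index both.\<close>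
    define X :: "'w list + 'w list \<Rightarrow> 'w rpoly" where "X = case_sum tuple_monom tuple_monom"
    obtain L where L: "rconst c * (\<Sum>i\<in>?I. rconst (w i) * (X i)\<^sup>2)
        - (\<Sum>a\<in>?A. \<Sum>b\<in>?B. rconst (?M a b) * (X (Inl a) * X (Inr b)))
        = (\<Sum>l\<leftarrow>L. (\<Sum>i\<in>?I. rconst (l i) * X i)\<^sup>2)"
      using weighted_squares_minus_bilinear_sos[OF fin dual] by blast
    have X_deg: "degree_le n (X i)" and X_vars: "vars_in W (X i)" and X_le: "?P (1 - (X i)\<^sup>2)"
      if i: "i \<in> ?I" for i
    proof -
      obtain \<alpha> where \<alpha>: "X i = tuple_monom \<alpha>" "set \<alpha> \<subseteq> W" "length \<alpha> \<le> n"
        using i mn by (auto simp: X_def tuples_def)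
      show "degree_le n (X i)"
        using degree_le_mono[OF degree_le_tuple_monom] \<alpha> by simp
      show "vars_in W (X i)" using vars_in_tuple_monom \<alpha> by simp
      show "?P (1 - (X i)\<^sup>2)"
        using sos_proves_mono[OF sos_proves_tuple_monom_square_le_1[OF W \<alpha>(2)]] \<alpha> by simp
    qed
    have "?P (\<Sum>i\<in>?I. rconst (c * w i) * (1 - (X i)\<^sup>2))"
      using c w by (intro sos_proves_sum W sos_proves_rconst_mult X_le) auto
    moreover have "?P (\<Sum>l\<leftarrow>L. (\<Sum>i\<in>?I. rconst (l i) * X i)\<^sup>2)"
    proof (rule sos_proves_sos[OF W])
      show "is_sos W (\<Sum>l\<leftarrow>L. (\<Sum>i\<in>?I. rconst (l i) * X i)\<^sup>2)"
        unfolding is_sos_def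
        by (rule exI[of _ "map (\<lambda>l. \<Sum>i\<in>?I. rconst (l i) * X i) L"])
          (auto simp: comp_def intro!: vars_in_sum vars_in_mult X_vars)
      show "degree_le (2 * n) (\<Sum>l\<leftarrow>L. (\<Sum>i\<in>?I. rconst (l i) * X i)\<^sup>2)"
        by (intro degree_le_sum_list degree_le_square degree_le_sum degree_le_rconst_mult X_deg)
    qed
    ultimately have "?P ((\<Sum>i\<in>?I. rconst (c * w i) * (1 - (X i)\<^sup>2)) +
        (\<Sum>l\<leftarrow>L. (\<Sum>i\<in>?I. rconst (l i) * X i)\<^sup>2))"
      by (rule sos_proves_add)
    \<comment> \<open>Total mass 1 turns the constant part into exactly \<open>c\<close>, while the
      squares cancel against those in \<open>L\<close>.\<close>
    also have "(\<Sum>i\<in>?I. rconst (c * w i) * (1 - (X i)\<^sup>2)) =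
        rconst c * rconst (sum w ?I) - rconst c * (\<Sum>i\<in>?I. rconst (w i) * (X i)\<^sup>2)"
      by (simp add: rconst_mult rconst_sum right_diff_distrib sum_subtractf sum_distrib_left mult.assoc)
    finally show ?thesis
      unfolding L[symmetric] by (simp add: w X_def)
  qed
  then show ?thesis
    unfolding sum_eq c_def by (subst sos_proves_iff_diff)
qed

theorem theoremH4:
  fixes W :: "'w set" and t :: nat and T :: "'w list \<Rightarrow> real"
  assumes "finite W" and "t \<ge> 1"
  shows "sos_proves W W (\<lambda>i. 1 - (rvar i)\<^sup>2) (2 * nat \<lceil>real t / 2\<rceil>)
           (\<Sum>\<alpha>\<in>tuples W t. rconst (T \<alpha>) * tuple_monom \<alpha>)
           (rconst (K_G * norm_inf_1 (tuples W (nat \<lfloor>real t / 2\<rfloor>))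
                                     (tuples W (nat \<lceil>real t / 2\<rceil>)) (flattening T)))"
proof -
  have t: "nat \<lfloor>real t / 2\<rfloor> + nat \<lceil>real t / 2\<rceil> = t" by linarith
  have "nat \<lfloor>real t / 2\<rfloor> \<le> nat \<lceil>real t / 2\<rceil>" by linarith
  from sos_proves_flattening_bound[OF assms(1) this, of T] show ?thesis
    unfolding t .
qed

end
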